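(* Assume that the semiparametric model $m$ is correctly specified with a unique parameter $\theta_0$ (Assumption 1 of the context) and that the moment functions evaluated at $\theta_0$ are uncorrelated over time (Assumption 2 of the context). Let $\varphi:\mathbb{R}\times\Xi\to\mathbb{R}^k$ be a strict $\mathcal{F}_{\mathcal{Y}|\mathcal{X}}$-identification function for the functional $\Gamma$. Let $\widehat\theta_{Z,T,\mathbb{A}^*}$ be the Z-estimator $$\widehat \theta_{Z,T,\mathbb{A}^*} = \operatorname*{arg\,min}_{\theta \in\Theta} \Big\|\frac{1}{T} \sum_{t=1}^T A^*_{t,C}(X_t,\theta)\,\varphi\big(Y_t,m(X_t,\theta)\big)\Big\|^2 ,$$ assumed to be asymptotically normal and based on the strict unconditional $\mathcal{F}_{\mathcal{Z}}$-identification functions $A^*_{t,C}(X_t,\theta)\varphi(Y_t,m(X_t,\theta))$, where the instrument matrices $\mathbb{A}^*=(A^*_{t,C})_{t\in\mathbb{N}}$ satisfy $$A_{t,C}^\ast(X_t,\theta_0) = C\, D_t(X_t,\theta_0)^\intercal S_t(X_t,\theta_0)^{-1}\qquad\text{for all } t\in\mathbb{N},$$ with $S_t(X_t,\theta_0)$ assumed to be invertible and $C$ any deterministic and invertible $q\times q$ matrix. Then: (i) The asymptotic covariance matrix of the Z-estimator $\widehat\theta_{Z,T,\mathbb{A}^*}$ is the limit (for $T\to\infty$) of $$\Lambda_T^{-1} := \left( \frac{1}{T} \sum_{t=1}^T \mathbb{E} \left[ D_t(X_t,\theta_0)^\intercal S_t(X_t,\theta_0)^{-1} D_t(X_t,\theta_0)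 \right] \right)^{-1}.$$ (ii) For any sequence of instrument matrices $\mathbb{A}=(A_t)_{t\in\mathbb{N}}$, it holds that $\Delta_{T,\mathbb{A}}^{-1}\Sigma_{T,\mathbb{A}}(\Delta_{T,\mathbb{A}}^{-1})^\intercal \succcurlyeq \Lambda_T^{-1}$ for all $T\ge 1$. (iii) If for some $t\in\{1,\ldots,T\}$ and for any non-singular and deterministic $q\times q$ matrix $C$ it holds that $\mathbb{P}\big(A_t(X_t,\theta_0)\neq A^*_{t,C}(X_t,\theta_0)\big)>0$, then $\Delta_{T,\mathbb{A}}^{-1}\Sigma_{T,\mathbb{A}}(\Delta_{T,\mathbb{A}}^{-1})^\intercal \succcurlyeq \Lambda_T^{-1}$ and $\Delta_{T,\mathbb{A}}^{-1}\Sigma_{T,\mathbb{A}}(\Delta_{T,\mathbb{A}}^{-1})^\intercal \neq \Lambda_T^{-1}$.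
   Context: Setting. $Z_t=(Y_t,X_t)$, $t\in\mathbb{N}$, is a time series with real-valued responses $Y_t$ and $\mathbb{R}^p$-valued regressors $X_t$. $\mathcal{F}_{\mathcal{Z}}$ is a class of possible joint distributions of $Z_t$; it induces a class $\mathcal{F}_{\mathcal{Y}|\mathcal{X}}$ of conditional distributions $F_t$ of $Y_t$ given $X_t$. Write $\mathbb{E}_t[\cdot]=\mathbb{E}[\cdot\mid X_t]$. Equalities of random variables are meant almost surely. $\Gamma:\mathcal{F}_{\mathcal{Y}|\mathcal{X}}\to\Xi\subseteq\mathbb{R}^k$ is a measurable functional, $\Theta\subseteq\mathbb{R}^q$ a parameter space with non-empty interior, and $m:\mathbb{R}^p\times\Theta\to\Xi$ a parametric model, differentiable in $\theta$. Assumption 1. For all distributions $F_{Z_t}\in\mathcal{F}_{\mathcal{Z}}$ of $Z_t$, there is a unique and time-independent $\theta_0=\theta_0(F_{Z_t})\in\operatorname{int}(\Theta)$ such that $m(X_t,\theta_0)=\Gamma(F_t)$ for all $t\in\mathbb{N}$. Identification functions. A map $\varphi:\mathbb{R}\times\Xi\to\mathbb{R}^k$ such that $\mathbb{E}[\varphi(Y,\xi)]$ exists and is finite for all $Y\sim F\in\mathcal{F}$, $\xi\in\Xi$, is a strict $\mathcal{F}$-identification function for $\Gamma$ if for all $Y\sim F\in\mathcal{F}$ and all $\xi\in\Xi$: $\mathbb{E}[\varphi(Y,\xi)]=0$ if and only if $\xi=\Gamma(F)$. Functions $\psi_t(Y_t,X_t,\theta)\in\mathbb{R}^q$ are strict unconditional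 $\mathcal{F}_{\mathcal{Z}}$-identification functions (for $\theta_0$) if for all $\theta\in\Theta$ and all $t\in\mathbb{N}$: $\mathbb{E}[\psi_t(Y_t,X_t,\theta)]=0$ if and only if $\theta=\theta_0$. Instrument matrices and moment functions. A sequence of instrument matrices is $\mathbb{A}=(A_t)_{t\in\mathbb{N}}$ with $A_t(X_t,\theta)\in\mathbb{R}^{q\times k}$; the associated moment functions are $\psi_t(Y_t,X_t,\theta)=A_t(X_t,\theta)\varphi(Y_t,m(X_t,\theta))$ and the associated Z-estimator is $\widehat\theta_{Z,T,\mathbb{A}}=\operatorname{arg\,min}_{\theta\in\Theta}\|\frac1T\sum_{t=1}^T\psi_t(Y_t,X_t,\theta)\|^2$. Assumption 2. The sequence $(\psi_t(Y_t,X_t,\theta_0))_{t\in\mathbb{N}}$ is uncorrelated. Further notation: $$S_t(X_t,\theta)=\mathbb{E}_t\big[\varphi(Y_t,m(X_t,\theta))\varphi(Y_t,m(X_t,\theta))^\intercal\big]\in\mathbb{R}^{k\times k},$$ $D_t(X_t,\theta)\in\mathbb{R}^{k\times q}$ is the Jacobian matrix with respect to $\theta$ of $\theta\mapsto\mathbb{E}_t[\varphi(Y_t,m(X_t,\theta))]$, $$\Sigma_{T,\mathbb{A}}=\frac1T\sum_{t=1}^T\mathbb{E}\big[A_t(X_t,\theta_0)S_t(X_t,\theta_0)A_t(X_t,\theta_0)^\intercal\big],\qquad \Delta_{T,\mathbb{A}}=\frac1T\sum_{t=1}^T\mathbb{E}\big[A_t(X_t,\theta_0)D_t(X_t,\theta_0)\big],$$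 both in $\mathbb{R}^{q\times q}$. All expectations and all inverses that are written are assumed to exist. Asymptotic normality of $\widehat\theta_{Z,T,\mathbb{A}}$ means $\Sigma_{T,\mathbb{A}}^{-1/2}\Delta_{T,\mathbb{A}}\sqrt{T}(\widehat\theta_{Z,T,\mathbb{A}}-\theta_0)\to\mathcal{N}(0,I_q)$ in distribution as $T\to\infty$, and the asymptotic covariance matrix of the estimator is the limit of $\Delta_{T,\mathbb{A}}^{-1}\Sigma_{T,\mathbb{A}}(\Delta_{T,\mathbb{A}}^{-1})^\intercal$ for $T\to\infty$. For symmetric matrices, $A\succcurlyeq B$ (Loewner order) means that $A-B$ is positive semi-definite. *)

theory Defs
  imports "HOL-Probability.Probability"
begin

section \<open>Matrices\<close>

text \<open>A \<open>q \<times> k\<close> matrix has type \<open>real ^ 'k ^ 'q\<close> (rows are indexed by \<open>'q\<close>).\<close>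

definition outer :: "real ^ 'n \<Rightarrow> real ^ 'm \<Rightarrow> real ^ 'm ^ 'n" where
  "outer u v = (\<chi> i j. u $ i * v $ j)"

definition pos_semidef :: "real ^ 'n ^ 'n \<Rightarrow> bool" where
  "pos_semidef A \<longleftrightarrow> transpose A = A \<and> (\<forall>v. 0 \<le> v \<bullet> (A *v v))"

definition loewner_ge :: "real ^ 'n ^ 'n \<Rightarrow> real ^ 'n ^ 'n \<Rightarrow> bool" (infix \<open>\<succeq>\<^sub>L\<close> 50) where
  "A \<succeq>\<^sub>L B \<longleftrightarrow> pos_semidef (A - B)"

text \<open>The positive semi-definite square root; meaningful for positive semi-definite arguments only.\<close>

definition matrix_sqrt :: "real ^ 'n ^ 'n \<Rightarrow> real ^ 'n ^ 'n" where
  "matrix_sqrt A = (THE B. pos_semidef B \<and> B ** B = A)"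


section \<open>Probability\<close>

definition std_normal_vec :: "(real ^ 'n) measure" where
  "std_normal_vec = density lborel (\<lambda>x. ennreal (\<Prod>i\<in>UNIV. std_normal_density (x $ i)))"

text \<open>The library has weak convergence only for measures on the real line.\<close>

definition conv_in_distr ::
    "'w measure \<Rightarrow> (nat \<Rightarrow> 'w \<Rightarrow> 'b::euclidean_space) \<Rightarrow> 'b measure \<Rightarrow> bool" where
  "conv_in_distr M W N \<longleftrightarrow>
     (\<forall>f::'b \<Rightarrow> real. continuous_on UNIV f \<and> bounded (range f) \<longrightarrow>
        (\<lambda>T. \<integral>\<omega>. f (W T \<omega>) \<partial>M) \<longlonglongrightarrow> (\<integral>x. f x \<partial>N))"

text \<open>Time runs through \<open>t \<ge> 1\<close>; values of time-indexed families at \<open>0\<close> are irrelevant.\<close>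

definition uncorrelated_seq :: "'w measure \<Rightarrow> (nat \<Rightarrow> 'w \<Rightarrow> real ^ 'q) \<Rightarrow> bool" where
  "uncorrelated_seq M W \<longleftrightarrow>
     (\<forall>t\<ge>1. integrable M (W t)) \<and>
     (\<forall>s\<ge>1. \<forall>t\<ge>1. s \<noteq> t \<longrightarrow>
        integrable M (\<lambda>\<omega>. outer (W s \<omega> - (\<integral>\<omega>. W s \<omega> \<partial>M)) (W t \<omega> - (\<integral>\<omega>. W t \<omega> \<partial>M))) \<and>
        (\<integral>\<omega>. outer (W s \<omega> - (\<integral>\<omega>. W s \<omega> \<partial>M)) (W t \<omega> - (\<integral>\<omega>. W t \<omega> \<partial>M)) \<partial>M) = 0)"

text \<open>
  \<open>K\<close> is a regular conditional distribution of the first component given the second one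
  under the joint law \<open>P\<close>.
\<close>

definition cond_distr ::
    "(real \<times> (real ^ 'p)) measure \<Rightarrow> (real ^ 'p \<Rightarrow> real measure) \<Rightarrow> bool" where
  "cond_distr P K \<longleftrightarrow>
     K \<in> borel \<rightarrow>\<^sub>M prob_algebra borel \<and>
     (\<forall>A\<in>sets borel. \<forall>B\<in>sets borel.
        emeasure P (A \<times> B) = (\<integral>\<^sup>+x. emeasure (K x) A * indicator B x \<partial>(distr P borel snd)))"


section \<open>The semiparametric model\<close>

text \<open>
  A member of the class \<open>FZ\<close> is a family \<open>t \<mapsto> G t\<close> consisting of the joint distributions of
  \<open>(Y\<^sub>t, X\<^sub>t)\<close>, so that it makes sense to require one parameter for all \<open>t\<close>.
  Conditional distributions are determined only almost surely. Hence a version is fixed: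
  \<open>\<kappa> P\<close> is the chosen regular conditional distribution under the joint law \<open>P\<close>. The notation
  \<open>E\<^sub>t[g(Y\<^sub>t, X\<^sub>t)]\<close> is rendered as the integral of \<open>\<lambda>y. g (y, x)\<close> with respect to
  \<open>F t x\<close>, \<open>F t = \<kappa> (G t)\<close>, at \<open>x = X\<^sub>t\<close>.
\<close>

definition distribution_class ::
    "(nat \<Rightarrow> (real \<times> (real ^ 'p)) measure) set
      \<Rightarrow> ((real \<times> (real ^ 'p)) measure \<Rightarrow> real ^ 'p \<Rightarrow> real measure) \<Rightarrow> bool" where
  "distribution_class FZ \<kappa> \<longleftrightarrow>
     (\<forall>G\<in>FZ. \<forall>t\<ge>1. prob_space (G t) \<and> sets (G t) = sets borel \<and> cond_distr (G t) (\<kappa> (G t)))"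

definition induced_class ::
    "(nat \<Rightarrow> (real \<times> (real ^ 'p)) measure) set
      \<Rightarrow> ((real \<times> (real ^ 'p)) measure \<Rightarrow> real ^ 'p \<Rightarrow> real measure) \<Rightarrow> real measure set" where
  "induced_class FZ \<kappa> = {\<kappa> (G t) x | G t x. G \<in> FZ \<and> t \<ge> 1}"

definition joint_law ::
    "'w measure \<Rightarrow> (nat \<Rightarrow> 'w \<Rightarrow> real) \<Rightarrow> (nat \<Rightarrow> 'w \<Rightarrow> real ^ 'p) \<Rightarrow> nat \<Rightarrow> (real \<times> (real ^ 'p)) measure" where
  "joint_law M Y X t = distr M borel (\<lambda>\<omega>. (Y t \<omega>, X t \<omega>))"

definition measurable_functional ::
    "real measure set \<Rightarrow> (real ^ 'k) set \<Rightarrow> (real measure \<Rightarrow> real ^ 'k) \<Rightarrow> bool" where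
  "measurable_functional \<F> \<Xi> \<Gamma> \<longleftrightarrow>
     \<Gamma> \<in> borel_measurable (restrict_space (prob_algebra borel) \<F>) \<and> (\<forall>F\<in>\<F>. \<Gamma> F \<in> \<Xi>)"

definition parametric_model ::
    "(real ^ 'q) set \<Rightarrow> (real ^ 'k) set \<Rightarrow> (real ^ 'p \<Rightarrow> real ^ 'q \<Rightarrow> real ^ 'k) \<Rightarrow> bool" where
  "parametric_model \<Theta> \<Xi> m \<longleftrightarrow>
     (\<forall>x. \<forall>\<theta>\<in>\<Theta>. m x \<theta> \<in> \<Xi>) \<and>
     (\<forall>\<theta>\<in>\<Theta>. (\<lambda>x. m x \<theta>) \<in> borel_measurable borel) \<and>
     (\<forall>x. m x differentiable_on \<Theta>)"

definition is_true_param ::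
    "((real \<times> (real ^ 'p)) measure \<Rightarrow> real ^ 'p \<Rightarrow> real measure) \<Rightarrow> (real measure \<Rightarrow> real ^ 'k)
      \<Rightarrow> (real ^ 'q) set \<Rightarrow> (real ^ 'p \<Rightarrow> real ^ 'q \<Rightarrow> real ^ 'k)
      \<Rightarrow> (nat \<Rightarrow> (real \<times> (real ^ 'p)) measure) \<Rightarrow> real ^ 'q \<Rightarrow> bool" where
  "is_true_param \<kappa> \<Gamma> \<Theta> m G \<theta> \<longleftrightarrow>
     \<theta> \<in> interior \<Theta> \<and> (\<forall>t\<ge>1. AE (y, x) in G t. m x \<theta> = \<Gamma> (\<kappa> (G t) x))"

definition correctly_specified ::
    "(nat \<Rightarrow> (real \<times> (real ^ 'p)) measure) set
      \<Rightarrow> ((real \<times> (real ^ 'p)) measure \<Rightarrow> real ^ 'p \<Rightarrow> real measure) \<Rightarrow> (real measure \<Rightarrow> real ^ 'k)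
      \<Rightarrow> (real ^ 'q) set \<Rightarrow> (real ^ 'p \<Rightarrow> real ^ 'q \<Rightarrow> real ^ 'k) \<Rightarrow> bool" where
  "correctly_specified FZ \<kappa> \<Gamma> \<Theta> m \<longleftrightarrow> (\<forall>G\<in>FZ. \<exists>!\<theta>. is_true_param \<kappa> \<Gamma> \<Theta> m G \<theta>)"

definition true_param ::
    "((real \<times> (real ^ 'p)) measure \<Rightarrow> real ^ 'p \<Rightarrow> real measure) \<Rightarrow> (real measure \<Rightarrow> real ^ 'k)
      \<Rightarrow> (real ^ 'q) set \<Rightarrow> (real ^ 'p \<Rightarrow> real ^ 'q \<Rightarrow> real ^ 'k)
      \<Rightarrow> (nat \<Rightarrow> (real \<times> (real ^ 'p)) measure) \<Rightarrow> real ^ 'q" where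
  "true_param \<kappa> \<Gamma> \<Theta> m G = (THE \<theta>. is_true_param \<kappa> \<Gamma> \<Theta> m G \<theta>)"


section \<open>Identification functions and moment functions\<close>

definition strict_id_fun ::
    "real measure set \<Rightarrow> (real ^ 'k) set \<Rightarrow> (real measure \<Rightarrow> real ^ 'k)
      \<Rightarrow> (real \<Rightarrow> real ^ 'k \<Rightarrow> real ^ 'k) \<Rightarrow> bool" where
  "strict_id_fun \<F> \<Xi> \<Gamma> \<phi> \<longleftrightarrow>
     case_prod \<phi> \<in> borel_measurable (borel \<Otimes>\<^sub>M restrict_space borel \<Xi>) \<and>
     (\<forall>F\<in>\<F>. \<forall>\<xi>\<in>\<Xi>. integrable F (\<lambda>y. \<phi> y \<xi>) \<and> ((\<integral>y. \<phi> y \<xi> \<partial>F) = 0 \<longleftrightarrow> \<xi> = \<Gamma> F))"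

definition moment_fun ::
    "(real \<Rightarrow> real ^ 'k \<Rightarrow> real ^ 'k) \<Rightarrow> (real ^ 'p \<Rightarrow> real ^ 'q \<Rightarrow> real ^ 'k)
      \<Rightarrow> (nat \<Rightarrow> real ^ 'p \<Rightarrow> real ^ 'q \<Rightarrow> real ^ 'k ^ 'q) \<Rightarrow> nat \<Rightarrow> real \<Rightarrow> real ^ 'p \<Rightarrow> real ^ 'q \<Rightarrow> real ^ 'q" where
  "moment_fun \<phi> m A t y x \<theta> = A t x \<theta> *v \<phi> y (m x \<theta>)"

text \<open>The parameter \<open>\<theta>0\<close> is a function of the underlying member of the class \<open>FZ\<close>.\<close>

definition strict_uncond_id_funs ::
    "(nat \<Rightarrow> (real \<times> (real ^ 'p)) measure) set \<Rightarrow> (real ^ 'q) set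
      \<Rightarrow> ((nat \<Rightarrow> (real \<times> (real ^ 'p)) measure) \<Rightarrow> real ^ 'q)
      \<Rightarrow> (nat \<Rightarrow> real \<Rightarrow> real ^ 'p \<Rightarrow> real ^ 'q \<Rightarrow> real ^ 'q) \<Rightarrow> bool" where
  "strict_uncond_id_funs FZ \<Theta> \<theta>0 \<psi> \<longleftrightarrow>
     (\<forall>G\<in>FZ. \<forall>\<theta>\<in>\<Theta>. \<forall>t\<ge>1.
        integrable (G t) (\<lambda>(y, x). \<psi> t y x \<theta>) \<and>
        ((\<integral>(y, x). \<psi> t y x \<theta> \<partial>(G t)) = 0 \<longleftrightarrow> \<theta> = \<theta>0 G))"

definition is_Z_estimator ::
    "'w measure \<Rightarrow> (nat \<Rightarrow> 'w \<Rightarrow> real) \<Rightarrow> (nat \<Rightarrow> 'w \<Rightarrow> real ^ 'p) \<Rightarrow> (real ^ 'q) set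
      \<Rightarrow> (nat \<Rightarrow> real \<Rightarrow> real ^ 'p \<Rightarrow> real ^ 'q \<Rightarrow> real ^ 'q) \<Rightarrow> (nat \<Rightarrow> 'w \<Rightarrow> real ^ 'q) \<Rightarrow> bool" where
  "is_Z_estimator M Y X \<Theta> \<psi> \<theta>hat \<longleftrightarrow>
     (\<forall>T\<ge>1. \<theta>hat T \<in> borel_measurable M \<and>
        (AE \<omega> in M. is_arg_min
           (\<lambda>\<theta>. (norm ((1 / real T) *\<^sub>R (\<Sum>t=1..T. \<psi> t (Y t \<omega>) (X t \<omega>) \<theta>)))\<^sup>2)
           (\<lambda>\<theta>. \<theta> \<in> \<Theta>) (\<theta>hat T \<omega>)))"


section \<open>Asymptotic covariance\<close>

definition S_mat ::
    "(real \<Rightarrow> real ^ 'k \<Rightarrow> real ^ 'k) \<Rightarrow> (real ^ 'p \<Rightarrow> real ^ 'q \<Rightarrow> real ^ 'k)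
      \<Rightarrow> (nat \<Rightarrow> real ^ 'p \<Rightarrow> real measure) \<Rightarrow> nat \<Rightarrow> real ^ 'p \<Rightarrow> real ^ 'q \<Rightarrow> real ^ 'k ^ 'k" where
  "S_mat \<phi> m F t x \<theta> = (\<integral>y. outer (\<phi> y (m x \<theta>)) (\<phi> y (m x \<theta>)) \<partial>(F t x))"

definition D_mat ::
    "(real \<Rightarrow> real ^ 'k \<Rightarrow> real ^ 'k) \<Rightarrow> (real ^ 'p \<Rightarrow> real ^ 'q \<Rightarrow> real ^ 'k)
      \<Rightarrow> (nat \<Rightarrow> real ^ 'p \<Rightarrow> real measure) \<Rightarrow> nat \<Rightarrow> real ^ 'p \<Rightarrow> real ^ 'q \<Rightarrow> real ^ 'q ^ 'k" where
  "D_mat \<phi> m F t x \<theta> = jacobian (\<lambda>\<theta>'. \<integral>y. \<phi> y (m x \<theta>') \<partial>(F t x)) (at \<theta>)"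

text \<open>
  Below \<open>A\<close>, \<open>S\<close>, \<open>D\<close> are functions of \<open>t\<close>, \<open>x\<close> and \<open>\<theta>\<close>, evaluated at
  \<open>x = X\<^sub>t\<close> and at the parameter \<open>\<theta>0\<close>.
\<close>

definition Sigma_mat ::
    "'w measure \<Rightarrow> (nat \<Rightarrow> 'w \<Rightarrow> real ^ 'p) \<Rightarrow> (nat \<Rightarrow> real ^ 'p \<Rightarrow> real ^ 'q \<Rightarrow> real ^ 'k ^ 'k)
      \<Rightarrow> real ^ 'q \<Rightarrow> (nat \<Rightarrow> real ^ 'p \<Rightarrow> real ^ 'q \<Rightarrow> real ^ 'k ^ 'q) \<Rightarrow> nat \<Rightarrow> real ^ 'q ^ 'q" where
  "Sigma_mat M X S \<theta>0 A T = (1 / real T) *\<^sub>R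
     (\<Sum>t=1..T. \<integral>\<omega>. A t (X t \<omega>) \<theta>0 ** S t (X t \<omega>) \<theta>0 ** transpose (A t (X t \<omega>) \<theta>0) \<partial>M)"

definition Delta_mat ::
    "'w measure \<Rightarrow> (nat \<Rightarrow> 'w \<Rightarrow> real ^ 'p) \<Rightarrow> (nat \<Rightarrow> real ^ 'p \<Rightarrow> real ^ 'q \<Rightarrow> real ^ 'q ^ 'k)
      \<Rightarrow> real ^ 'q \<Rightarrow> (nat \<Rightarrow> real ^ 'p \<Rightarrow> real ^ 'q \<Rightarrow> real ^ 'k ^ 'q) \<Rightarrow> nat \<Rightarrow> real ^ 'q ^ 'q" where
  "Delta_mat M X D \<theta>0 A T = (1 / real T) *\<^sub>R
     (\<Sum>t=1..T. \<integral>\<omega>. A t (X t \<omega>) \<theta>0 ** D t (X t \<omega>) \<theta>0 \<partial>M)"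

definition Lambda_mat ::
    "'w measure \<Rightarrow> (nat \<Rightarrow> 'w \<Rightarrow> real ^ 'p) \<Rightarrow> (nat \<Rightarrow> real ^ 'p \<Rightarrow> real ^ 'q \<Rightarrow> real ^ 'k ^ 'k)
      \<Rightarrow> (nat \<Rightarrow> real ^ 'p \<Rightarrow> real ^ 'q \<Rightarrow> real ^ 'q ^ 'k) \<Rightarrow> real ^ 'q \<Rightarrow> nat \<Rightarrow> real ^ 'q ^ 'q" where
  "Lambda_mat M X S D \<theta>0 T = (1 / real T) *\<^sub>R
     (\<Sum>t=1..T. \<integral>\<omega>. transpose (D t (X t \<omega>) \<theta>0) ** matrix_inv (S t (X t \<omega>) \<theta>0) ** D t (X t \<omega>) \<theta>0 \<partial>M)"

definition sandwich :: "real ^ 'q ^ 'q \<Rightarrow> real ^ 'q ^ 'q \<Rightarrow> real ^ 'q ^ 'q" where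
  "sandwich \<Delta> \<Sigma> = matrix_inv \<Delta> ** \<Sigma> ** transpose (matrix_inv \<Delta>)"

text \<open>Instrument matrices for which the expectations in \<open>\<Sigma>\<close> and \<open>\<Delta>\<close> exist.\<close>

definition instrument_matrices ::
    "'w measure \<Rightarrow> (nat \<Rightarrow> 'w \<Rightarrow> real ^ 'p) \<Rightarrow> (real ^ 'q) set
      \<Rightarrow> (nat \<Rightarrow> real ^ 'p \<Rightarrow> real ^ 'q \<Rightarrow> real ^ 'k ^ 'k) \<Rightarrow> (nat \<Rightarrow> real ^ 'p \<Rightarrow> real ^ 'q \<Rightarrow> real ^ 'q ^ 'k)
      \<Rightarrow> real ^ 'q \<Rightarrow> (nat \<Rightarrow> real ^ 'p \<Rightarrow> real ^ 'q \<Rightarrow> real ^ 'k ^ 'q) \<Rightarrow> bool" where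
  "instrument_matrices M X \<Theta> S D \<theta>0 A \<longleftrightarrow>
     (\<forall>t\<ge>1. (\<forall>\<theta>\<in>\<Theta>. (\<lambda>x. A t x \<theta>) \<in> borel_measurable borel) \<and>
        integrable M (\<lambda>\<omega>. A t (X t \<omega>) \<theta>0 ** S t (X t \<omega>) \<theta>0 ** transpose (A t (X t \<omega>) \<theta>0)) \<and>
        integrable M (\<lambda>\<omega>. A t (X t \<omega>) \<theta>0 ** D t (X t \<omega>) \<theta>0))"

definition efficient_instrument ::
    "(nat \<Rightarrow> real ^ 'p \<Rightarrow> real ^ 'q \<Rightarrow> real ^ 'k ^ 'k) \<Rightarrow> (nat \<Rightarrow> real ^ 'p \<Rightarrow> real ^ 'q \<Rightarrow> real ^ 'q ^ 'k)
      \<Rightarrow> real ^ 'q ^ 'q \<Rightarrow> nat \<Rightarrow> real ^ 'p \<Rightarrow> real ^ 'q \<Rightarrow> real ^ 'k ^ 'q" where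
  "efficient_instrument S D C t x \<theta> = C ** transpose (D t x \<theta>) ** matrix_inv (S t x \<theta>)"

definition asymptotically_normal ::
    "'w measure \<Rightarrow> (nat \<Rightarrow> real ^ 'q ^ 'q) \<Rightarrow> (nat \<Rightarrow> real ^ 'q ^ 'q)
      \<Rightarrow> (nat \<Rightarrow> 'w \<Rightarrow> real ^ 'q) \<Rightarrow> real ^ 'q \<Rightarrow> bool" where
  "asymptotically_normal M \<Delta> \<Sigma> \<theta>hat \<theta>0 \<longleftrightarrow>
     conv_in_distr M
       (\<lambda>T \<omega>. (matrix_inv (matrix_sqrt (\<Sigma> T)) ** \<Delta> T) *v (sqrt (real T) *\<^sub>R (\<theta>hat T \<omega> - \<theta>0)))
       std_normal_vec"

definition is_asymptotic_covariance ::
    "(nat \<Rightarrow> real ^ 'q ^ 'q) \<Rightarrow> (nat \<Rightarrow> real ^ 'q ^ 'q) \<Rightarrow> real ^ 'q ^ 'q \<Rightarrow> bool" where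
  "is_asymptotic_covariance \<Delta> \<Sigma> V \<longleftrightarrow> (\<lambda>T. sandwich (\<Delta> T) (\<Sigma> T)) \<longlonglongrightarrow> V"

end

theory Submission
  imports Defs
begin

text \<open>
  Write \<open>S\<^sub>t\<close>, \<open>D\<^sub>t\<close>, \<open>A\<^sub>t\<close> for the random matrices at the true parameter. Each \<open>S\<^sub>t\<close> is an
  average of matrices \<open>u u\<^sup>T\<close>, hence positive semi-definite, and being invertible it is almost surely
  positive definite. For fixed \<open>T\<close> put
  \<open>B\<^sub>t = \<Delta>\<^sup>-\<^sup>1 A\<^sub>t - \<Lambda>\<^sup>-\<^sup>1 D\<^sub>t\<^sup>T S\<^sub>t\<^sup>-\<^sup>1\<close>. Multiplying out \<open>B\<^sub>t S\<^sub>t B\<^sub>t\<^sup>T\<close> cancels every \<open>S\<^sub>t\<^sup>-\<^sup>1\<close> except the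
  one in \<open>D\<^sub>t\<^sup>T S\<^sub>t\<^sup>-\<^sup>1 D\<^sub>t\<close>, and taking expectations and averaging over time turns the two mixed terms
  and the last term into \<open>\<Lambda>\<^sup>-\<^sup>1\<close>, so that the time average of \<open>E[B\<^sub>t S\<^sub>t B\<^sub>t\<^sup>T]\<close> is
  exactly \<open>\<Delta>\<^sup>-\<^sup>1 \<Sigma> \<Delta>\<^sup>-\<^sup>T - \<Lambda>\<^sup>-\<^sup>1\<close> (\<open>sandwich_minus_eq\<close>).

  The lower bound follows since every \<open>B\<^sub>t S\<^sub>t B\<^sub>t\<^sup>T\<close> is positive semi-definite. If the bound is
  attained, then an average of positive semi-definite matrices vanishes, so each
  \<open>E[B\<^sub>t S\<^sub>t B\<^sub>t\<^sup>T]\<close> vanishes, and positive definiteness of \<open>S\<^sub>t\<close> forces \<open>B\<^sub>t = 0\<close> almost surely.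
  This says \<open>A\<^sub>t = (\<Delta> \<Lambda>\<^sup>-\<^sup>1) D\<^sub>t\<^sup>T S\<^sub>t\<^sup>-\<^sup>1\<close> with an invertible deterministic factor that is the same for
  all \<open>t \<le> T\<close>, so the instruments are efficient at all these times
  (\<open>efficient_if_bound_attained\<close>).

  For the efficient instruments themselves \<open>\<Delta> = C \<Lambda>\<close> and \<open>\<Sigma> = C \<Lambda> C\<^sup>T\<close>, so the sandwich
  collapses to \<open>\<Lambda>\<^sup>-\<^sup>1\<close> whenever \<open>\<Lambda>\<close> is invertible, and this is assumed for all large \<open>T\<close>.
\<close>

section \<open>Matrix algebra\<close>

lemma bounded_linear_matrix_sandwich:
  "bounded_linear (\<lambda>P :: real ^ 'n ^ 'm. (G :: real ^ 'm ^ 'l) ** P ** (H :: real ^ 'j ^ 'n))"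
  unfolding linear_conv_bounded_linear[symmetric]
  by (intro linearI)
    (simp_all add: matrix_matrix_mult_def vec_eq_iff sum.distrib sum_distrib_left algebra_simps)

lemma matrix_sandwich_average:
  fixes f :: "'i \<Rightarrow> real ^ 'n ^ 'm" and G :: "real ^ 'm ^ 'l" and H :: "real ^ 'j ^ 'n"
  shows "G ** (c *\<^sub>R (\<Sum>i\<in>I. f i)) ** H = c *\<^sub>R (\<Sum>i\<in>I. G ** f i ** H)"
proof -
  have lin: "linear (\<lambda>P. G ** P ** H)"
    using bounded_linear_matrix_sandwich by (rule bounded_linear.linear)
  show ?thesis by (simp only: linear_scale[OF lin] linear_sum[OF lin])
qed

lemma bounded_linear_transpose: "bounded_linear (transpose :: real ^ 'n ^ 'm \<Rightarrow> real ^ 'm ^ 'n)"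
  unfolding linear_conv_bounded_linear[symmetric]
  by (intro linearI) (simp_all add: transpose_def vec_eq_iff)

lemma bounded_linear_quadratic_form:
  "bounded_linear (\<lambda>P :: real ^ 'n ^ 'n. v \<bullet> (P *v v))"
  unfolding linear_conv_bounded_linear[symmetric]
  by (intro linearI)
    (simp_all add: matrix_vector_mult_add_rdistrib inner_add_right
      scaleR_matrix_vector_assoc[symmetric])

lemma matrix_mul_diff_left:
  fixes A B :: "real ^ 'n ^ 'm" and E :: "real ^ 'l ^ 'n"
  shows "(A - B) ** E = A ** E - B ** E"
  by (simp add: matrix_matrix_mult_def vec_eq_iff sum_subtractf left_diff_distrib)

lemma matrix_mul_diff_right:
  fixes E :: "real ^ 'n ^ 'm" and A B :: "real ^ 'l ^ 'n"
  shows "E ** (A - B) = E ** A - E ** B"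
  by (simp add: matrix_matrix_mult_def vec_eq_iff sum_subtractf right_diff_distrib)

lemma transpose_diff:
  fixes A B :: "real ^ 'n ^ 'm"
  shows "transpose (A - B) = transpose A - transpose B"
  by (simp add: transpose_def vec_eq_iff)

lemma matrix_mul_inv_left: "invertible A \<Longrightarrow> matrix_inv A ** A = mat 1"
  and matrix_mul_inv_right: "invertible A \<Longrightarrow> A ** matrix_inv A = mat 1"
  for A :: "real ^ 'n ^ 'n"
  unfolding invertible_def matrix_inv_def by (metis (mono_tags, lifting) someI_ex)+

lemma invertible_matrix_inv:
  fixes A :: "real ^ 'n ^ 'n"
  assumes "invertible A"
  shows "invertible (matrix_inv A)"
  using assms matrix_mul_inv_left matrix_mul_inv_right unfolding invertible_def by blast

lemma transpose_matrix_inv: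
  fixes A :: "real ^ 'n ^ 'n"
  assumes "invertible A"
  shows "transpose (matrix_inv A) = matrix_inv (transpose A)"
proof -
  have "transpose A ** transpose (matrix_inv A) = mat 1"
    by (metis assms matrix_mul_inv_left matrix_transpose_mul transpose_mat)
  then show ?thesis
    by (metis assms transpose_invertible matrix_mul_assoc matrix_mul_inv_left matrix_mul_lid
        matrix_mul_rid)
qed

text \<open>The algebraic heart: for symmetric invertible \<open>S\<close> the congruence produces only quantities
  whose expectations appear in \<open>\<Sigma>\<close>, \<open>\<Delta>\<close> and \<open>\<Lambda>\<close>.\<close>

lemma congruence_expansion:
  fixes G L :: "real ^ 'q ^ 'q" and A :: "real ^ 'k ^ 'q" and S :: "real ^ 'k ^ 'k"
    and D :: "real ^ 'q ^ 'k"
  assumes S: "invertible S" "transpose S = S"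
  defines "B \<equiv> G ** A - L ** transpose D ** matrix_inv S"
  shows "B ** S ** transpose B =
    G ** (A ** S ** transpose A) ** transpose G - G ** (A ** D) ** transpose L
    - (L ** transpose (A ** D) ** transpose G
       - L ** (transpose D ** matrix_inv S ** D) ** transpose L)"
proof -
  have tB: "transpose B = transpose A ** transpose G - matrix_inv S ** D ** transpose L"
    unfolding B_def transpose_diff matrix_transpose_mul transpose_matrix_inv[OF S(1)] S(2)
    by (simp add: matrix_mul_assoc)
  have BS: "B ** S = G ** A ** S - L ** transpose D"
    unfolding B_def matrix_mul_diff_left
    by (metis S(1) matrix_mul_assoc matrix_mul_inv_left matrix_mul_rid)
  have SS: "G ** A ** S ** matrix_inv S = G ** A"
    by (metis S(1) matrix_mul_assoc matrix_mul_inv_right matrix_mul_rid)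
  show ?thesis
    unfolding BS tB
    by (simp add: matrix_mul_diff_left matrix_mul_diff_right matrix_mul_assoc
        matrix_transpose_mul SS)
qed

lemma inner_congruence:
  fixes B :: "real ^ 'k ^ 'q" and S :: "real ^ 'k ^ 'k"
  shows "v \<bullet> ((B ** S ** transpose B) *v v) = (transpose B *v v) \<bullet> (S *v (transpose B *v v))"
  by (simp add: matrix_vector_mul_assoc[symmetric] dot_lmul_matrix[symmetric])

lemma pos_semidef_congruence:
  fixes B :: "real ^ 'k ^ 'q" and S :: "real ^ 'k ^ 'k"
  assumes "pos_semidef S"
  shows "pos_semidef (B ** S ** transpose B)"
  using assms unfolding pos_semidef_def inner_congruence
  by (simp add: matrix_transpose_mul matrix_mul_assoc)

lemma pos_semidef_sum:
  "(\<And>i. i \<in> I \<Longrightarrow> pos_semidef (P i)) \<Longrightarrow> pos_semidef (\<Sum>i\<in>I. P i)"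
proof (induction I rule: infinite_finite_induct)
  case (insert i I)
  then show ?case
    by (simp add: pos_semidef_def transpose_def vec_eq_iff matrix_vector_mult_add_rdistrib
        inner_add_right)
qed (simp_all add: pos_semidef_def transpose_def vec_eq_iff)

lemma pos_semidef_scaleR: "0 \<le> c \<Longrightarrow> pos_semidef P \<Longrightarrow> pos_semidef (c *\<^sub>R P)"
  by (simp add: pos_semidef_def transpose_def vec_eq_iff scaleR_matrix_vector_assoc[symmetric])

text \<open>A null vector \<open>v\<close> of the quadratic form minimises it. Moving from \<open>v\<close> in the direction \<open>- S v\<close>
  would decrease the form to first order unless \<open>S v = 0\<close>.\<close>

lemma pos_semidef_null_vector:
  fixes S :: "real ^ 'n ^ 'n"
  assumes S: "pos_semidef S" and v: "v \<bullet> (S *v v) = 0"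
  shows "S *v v = 0"
proof -
  define w where "w = S *v v"
  define a where "a = w \<bullet> w"
  define c where "c = w \<bullet> (S *v w)"
  \<comment> \<open>The form at \<open>v - s w\<close> is \<open>s\<^sup>2 c - 2 s a\<close>. The step \<open>s = a / c\<close> minimises it, and the \<open>1\<close>
    covers the case \<open>c = 0\<close>.\<close>
  define s where "s = a / (c + 1)"
  have c: "c \<ge> 0" using S by (simp add: c_def pos_semidef_def)
  have "v \<bullet> (S *v w) = (transpose S *v v) \<bullet> w"
    by (simp add: dot_lmul_matrix transpose_matrix_vector)
  also have "\<dots> = a"
    using S unfolding pos_semidef_def w_def a_def by simp
  finally have vw: "v \<bullet> (S *v w) = a" .
  have wv: "w \<bullet> (S *v v) = a" by (simp add: a_def w_def)
  have "0 \<le> (v - s *\<^sub>R w) \<bullet> (S *v (v - s *\<^sub>R w))"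
    using S by (simp add: pos_semidef_def)
  also have "\<dots> = s\<^sup>2 * c - 2 * s * a"
    by (simp add: matrix_vector_mult_diff_distrib matrix_vector_mult_scaleR inner_diff_left
        inner_diff_right v vw wv c_def[symmetric] power2_eq_square
        algebra_simps)
  also have "\<dots> = - (s * s * (c + 2))"
  proof -
    have "a = s * (c + 1)" using c by (simp add: s_def)
    then show ?thesis by algebra
  qed
  finally have "s * s * (c + 2) \<le> 0" by simp
  then have "s * s \<le> 0" using c by (simp add: mult_le_0_iff)
  then have "s = 0" by (auto simp: mult_le_0_iff)
  then have "a = 0" using c by (simp add: s_def)
  then show ?thesis by (simp add: a_def w_def)
qed

text \<open>The quadratic forms are nonnegative, so they cannot cancel in the sum and each of them vanishes;
  then every vector is a null vector of every \<open>P i\<close>.\<close>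

lemma pos_semidef_sum_eq_0:
  fixes P :: "'i \<Rightarrow> real ^ 'n ^ 'n"
  assumes I: "finite I" and P: "\<And>i. i \<in> I \<Longrightarrow> pos_semidef (P i)"
    and sum: "(\<Sum>i\<in>I. P i) = 0" and i: "i \<in> I"
  shows "P i = 0"
proof -
  have "P i *v v = 0" for v
  proof (rule pos_semidef_null_vector[OF P[OF i]])
    have "(\<Sum>i\<in>I. v \<bullet> (P i *v v)) = v \<bullet> ((\<Sum>i\<in>I. P i) *v v)"
      by (rule linear_sum[OF bounded_linear_quadratic_form[THEN bounded_linear.linear], symmetric])
    also have "\<dots> = 0" by (simp add: sum)
    finally show "v \<bullet> (P i *v v) = 0"
      using I P i by (subst (asm) sum_nonneg_eq_0_iff) (auto simp: pos_semidef_def)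
  qed
  then show ?thesis by (simp add: matrix_eq)
qed

section \<open>Expectations of random matrices\<close>

lemma pos_semidef_integral:
  fixes P :: "'w \<Rightarrow> real ^ 'n ^ 'n"
  assumes P: "integrable M P" "AE \<omega> in M. pos_semidef (P \<omega>)"
  shows "pos_semidef (\<integral>\<omega>. P \<omega> \<partial>M)"
  unfolding pos_semidef_def
proof (intro conjI allI)
  have "transpose (\<integral>\<omega>. P \<omega> \<partial>M) = (\<integral>\<omega>. transpose (P \<omega>) \<partial>M)"
    by (rule integral_bounded_linear[OF bounded_linear_transpose P(1), symmetric])
  also have "\<dots> = (\<integral>\<omega>. P \<omega> \<partial>M)"
    using integrable_bounded_linear[OF bounded_linear_transpose P(1)] P
    by (intro integral_cong_AE borel_measurable_integrable) (auto simp: pos_semidef_def)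
  finally show "transpose (\<integral>\<omega>. P \<omega> \<partial>M) = (\<integral>\<omega>. P \<omega> \<partial>M)" .
next
  fix v
  have "0 \<le> (\<integral>\<omega>. v \<bullet> (P \<omega> *v v) \<partial>M)"
    using P(2) by (intro integral_nonneg_AE) (auto simp: pos_semidef_def)
  then show "0 \<le> v \<bullet> ((\<integral>\<omega>. P \<omega> \<partial>M) *v v)"
    by (simp only: integral_bounded_linear[OF bounded_linear_quadratic_form P(1)])
qed

text \<open>The positive semi-definite analogue of the fact that a nonnegative function with integral zero
  vanishes almost everywhere; it is reduced to that fact along the coordinate vectors. The matrices \<open>P\<close> are a
  measurable version of the congruence.\<close>

lemma AE_zero_if_integral_congruence_zero:
  fixes B :: "'w \<Rightarrow> real ^ 'k ^ 'q" and S :: "'w \<Rightarrow> real ^ 'k ^ 'k"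
  assumes int: "integrable M P"
    and P: "AE \<omega> in M. P \<omega> = B \<omega> ** S \<omega> ** transpose (B \<omega>)"
    and S: "AE \<omega> in M. pos_semidef (S \<omega>) \<and> invertible (S \<omega>)"
    and zero: "(\<integral>\<omega>. P \<omega> \<partial>M) = 0"
  shows "AE \<omega> in M. B \<omega> = 0"
proof -
  have "AE \<omega> in M. transpose (B \<omega>) *v v = 0" for v
  proof -
    have "(\<integral>\<omega>. v \<bullet> (P \<omega> *v v) \<partial>M) = v \<bullet> ((\<integral>\<omega>. P \<omega> \<partial>M) *v v)"
      by (rule integral_bounded_linear[OF bounded_linear_quadratic_form int])
    then have 0: "(\<integral>\<omega>. v \<bullet> (P \<omega> *v v) \<partial>M) = 0"
      unfolding zero by simp
    have nonneg: "AE \<omega> in M. 0 \<le> v \<bullet> (P \<omega> *v v)"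
      using S P by eventually_elim (use pos_semidef_congruence in \<open>auto simp: pos_semidef_def\<close>)
    have "AE \<omega> in M. v \<bullet> (P \<omega> *v v) = 0"
      using integral_nonneg_eq_0_iff_AE[OF
          integrable_bounded_linear[OF bounded_linear_quadratic_form int] nonneg] 0 by blast
    with S P show ?thesis
    proof eventually_elim
      case (elim \<omega>)
      then have "S \<omega> *v (transpose (B \<omega>) *v v) = 0"
        by (intro pos_semidef_null_vector) (auto simp: inner_congruence)
      then show ?case
        using elim by (metis matrix_left_invertible_ker invertible_def)
    qed
  qed
  then have "AE \<omega> in M. \<forall>i. transpose (B \<omega>) *v axis i 1 = 0"
    by (subst AE_all_countable) blast
  then show ?thesis
    by eventually_elim
      (simp add: matrix_vector_mult_basis column_def transpose_def vec_eq_iff)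
qed

lemma pos_semidef_S_mat:
  fixes \<phi> :: "real \<Rightarrow> real ^ 'k \<Rightarrow> real ^ 'k"
  assumes "integrable (F t x) (\<lambda>y. outer (\<phi> y (m x \<theta>)) (\<phi> y (m x \<theta>)))"
  shows "pos_semidef (S_mat \<phi> m F t x \<theta>)"
  unfolding S_mat_def
proof (rule pos_semidef_integral[OF assms], intro AE_I2)
  fix y
  have "v \<bullet> (outer u u *v v) = (u \<bullet> v)\<^sup>2" for u v :: "real ^ 'k"
    by (simp add: outer_def matrix_vector_mult_def inner_vec_def power2_eq_square
        sum_product sum_distrib_left algebra_simps)
  moreover have "transpose (outer u u) = outer u u" for u :: "real ^ 'k"
    by (simp add: outer_def transpose_def mult.commute)
  ultimately show "pos_semidef (outer (\<phi> y (m x \<theta>)) (\<phi> y (m x \<theta>)))"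
    by (simp add: pos_semidef_def)
qed

section \<open>The variance bound\<close>

text \<open>From here on \<open>A\<close>, \<open>S\<close>, \<open>D\<close> are sequences of random matrices on the sample space. The sum over
  time carries a factor \<open>c\<close>. With \<open>I = {1..T}\<close> and \<open>c = 1 / T\<close>, the matrices \<open>info\<close>, \<open>moment_var\<close>
  and \<open>moment_jac\<close> are \<open>\<Lambda>\<close>, \<open>\<Sigma>\<close> and \<open>\<Delta>\<close>.\<close>

locale gmm_moments =
  fixes M :: "'w measure" and S :: "nat \<Rightarrow> 'w \<Rightarrow> real ^ 'k ^ 'k" and D :: "nat \<Rightarrow> 'w \<Rightarrow> real ^ 'q ^ 'k"
    and I :: "nat set" and c :: real
  assumes finite_I: "finite I" and c: "c > 0"
    and S: "t \<in> I \<Longrightarrow> AE \<omega> in M. pos_semidef (S t \<omega>) \<and> invertible (S t \<omega>)"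
    and info_integrable:
      "t \<in> I \<Longrightarrow> integrable M (\<lambda>\<omega>. transpose (D t \<omega>) ** matrix_inv (S t \<omega>) ** D t \<omega>)"
begin

definition info :: "real ^ 'q ^ 'q" where
  "info = c *\<^sub>R (\<Sum>t\<in>I. \<integral>\<omega>. transpose (D t \<omega>) ** matrix_inv (S t \<omega>) ** D t \<omega> \<partial>M)"

definition moment_var :: "(nat \<Rightarrow> 'w \<Rightarrow> real ^ 'k ^ 'q) \<Rightarrow> real ^ 'q ^ 'q" where
  "moment_var A = c *\<^sub>R (\<Sum>t\<in>I. \<integral>\<omega>. A t \<omega> ** S t \<omega> ** transpose (A t \<omega>) \<partial>M)"

definition moment_jac :: "(nat \<Rightarrow> 'w \<Rightarrow> real ^ 'k ^ 'q) \<Rightarrow> real ^ 'q ^ 'q" where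
  "moment_jac A = c *\<^sub>R (\<Sum>t\<in>I. \<integral>\<omega>. A t \<omega> ** D t \<omega> \<partial>M)"

lemma transpose_info: "transpose info = info"
proof -
  have "pos_semidef info"
    unfolding info_def
  proof (intro pos_semidef_scaleR pos_semidef_sum pos_semidef_integral info_integrable)
    fix t assume "t \<in> I"
    from S[OF this] show "AE \<omega> in M. pos_semidef (transpose (D t \<omega>) ** matrix_inv (S t \<omega>) ** D t \<omega>)"
    proof eventually_elim
      case (elim \<omega>)
      have t: "transpose (matrix_inv (S t \<omega>)) = matrix_inv (S t \<omega>)"
        using elim by (simp add: transpose_matrix_inv pos_semidef_def)
      have "matrix_inv (S t \<omega>) ** S t \<omega> ** transpose (matrix_inv (S t \<omega>)) = matrix_inv (S t \<omega>)"
        using elim by (simp add: t matrix_mul_inv_left)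
      then have "pos_semidef (matrix_inv (S t \<omega>))"
        using pos_semidef_congruence[of "S t \<omega>" "matrix_inv (S t \<omega>)"] elim by simp
      from pos_semidef_congruence[OF this, of "transpose (D t \<omega>)"] show ?case
        by simp
    qed
  qed (use c in auto)
  then show ?thesis by (simp add: pos_semidef_def)
qed

definition admissible :: "(nat \<Rightarrow> 'w \<Rightarrow> real ^ 'k ^ 'q) \<Rightarrow> bool" where
  "admissible A \<longleftrightarrow> (\<forall>t\<in>I. integrable M (\<lambda>\<omega>. A t \<omega> ** S t \<omega> ** transpose (A t \<omega>)) \<and>
     integrable M (\<lambda>\<omega>. A t \<omega> ** D t \<omega>))"

text \<open>To first order, the Z-estimator with instruments \<open>A\<close> deviates from the true parameter by the
  average of \<open>- \<Delta>\<^sup>-\<^sup>1 A\<^sub>t \<phi>\<^sub>t\<close>. The matrix below compares the factor \<open>\<Delta>\<^sup>-\<^sup>1 A\<^sub>t\<close> with its value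
  \<open>\<Lambda>\<^sup>-\<^sup>1 D\<^sub>t\<^sup>T S\<^sub>t\<^sup>-\<^sup>1\<close> for the efficient instruments.\<close>

definition excess :: "(nat \<Rightarrow> 'w \<Rightarrow> real ^ 'k ^ 'q) \<Rightarrow> nat \<Rightarrow> 'w \<Rightarrow> real ^ 'k ^ 'q" where
  "excess A t \<omega> = matrix_inv (moment_jac A) ** A t \<omega>
     - matrix_inv info ** transpose (D t \<omega>) ** matrix_inv (S t \<omega>)"

text \<open>This is the expansion of \<open>B S B\<^sup>T\<close> for \<open>B = excess A t\<close>. It agrees with that congruence only
  almost surely, where \<open>S\<close> is symmetric and invertible, but unlike the congruence it is
  visibly measurable and integrable for admissible \<open>A\<close>.\<close>

definition excess_var :: "(nat \<Rightarrow> 'w \<Rightarrow> real ^ 'k ^ 'q) \<Rightarrow> nat \<Rightarrow> 'w \<Rightarrow> real ^ 'q ^ 'q" where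
  "excess_var A t \<omega> = (let G = matrix_inv (moment_jac A); L = matrix_inv info in
     G ** (A t \<omega> ** S t \<omega> ** transpose (A t \<omega>)) ** transpose G
     - G ** (A t \<omega> ** D t \<omega>) ** transpose L
     - (L ** transpose (A t \<omega> ** D t \<omega>) ** transpose G
        - L ** (transpose (D t \<omega>) ** matrix_inv (S t \<omega>) ** D t \<omega>) ** transpose L))"

lemma AE_excess_var:
  assumes "t \<in> I"
  shows "AE \<omega> in M. excess_var A t \<omega> = excess A t \<omega> ** S t \<omega> ** transpose (excess A t \<omega>)"
  using S[OF assms]
  by eventually_elim (simp add: excess_var_def excess_def Let_def congruence_expansion pos_semidef_def)

lemma has_bochner_integral_excess_var:
  assumes A: "admissible A" and t: "t \<in> I"
  defines "G \<equiv> matrix_inv (moment_jac A)" and "L \<equiv> matrix_inv info"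
  shows "has_bochner_integral M (excess_var A t)
    (G ** (\<integral>\<omega>. A t \<omega> ** S t \<omega> ** transpose (A t \<omega>) \<partial>M) ** transpose G
     - G ** (\<integral>\<omega>. A t \<omega> ** D t \<omega> \<partial>M) ** transpose L
     - (L ** transpose (\<integral>\<omega>. A t \<omega> ** D t \<omega> \<partial>M) ** transpose G
        - L ** (\<integral>\<omega>. transpose (D t \<omega>) ** matrix_inv (S t \<omega>) ** D t \<omega> \<partial>M) ** transpose L))"
  unfolding excess_var_def[abs_def] Let_def G_def L_def
  using A t
  by (intro has_bochner_integral_diff
      has_bochner_integral_bounded_linear[OF bounded_linear_matrix_sandwich]
      has_bochner_integral_bounded_linear[OF bounded_linear_transpose]
      has_bochner_integral_integrable info_integrable) (auto simp: admissible_def)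

text \<open>The normalisations \<open>\<Delta>\<^sup>-\<^sup>1\<close> and \<open>\<Lambda>\<^sup>-\<^sup>1\<close> in \<open>excess\<close> are chosen so that, after averaging, both
  mixed terms of the expansion become \<open>\<Lambda>\<^sup>-\<^sup>1\<close>, as does the pure efficient term: no cross terms are left.
  This is a Pythagorean identity in which the efficient instruments are the foot of the
  perpendicular.\<close>

lemma sandwich_minus_eq:
  assumes A: "admissible A" and inv: "invertible (moment_jac A)" "invertible info"
  shows "sandwich (moment_jac A) (moment_var A) - matrix_inv info = c *\<^sub>R (\<Sum>t\<in>I. \<integral>\<omega>. excess_var A t \<omega> \<partial>M)"
proof -
  define G where "G = matrix_inv (moment_jac A)"
  define L where "L = matrix_inv info"
  let ?V = "\<lambda>t. \<integral>\<omega>. A t \<omega> ** S t \<omega> ** transpose (A t \<omega>) \<partial>M"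
  let ?J = "\<lambda>t. \<integral>\<omega>. A t \<omega> ** D t \<omega> \<partial>M"
  let ?E = "\<lambda>t. \<integral>\<omega>. transpose (D t \<omega>) ** matrix_inv (S t \<omega>) ** D t \<omega> \<partial>M"
  have tr: "transpose (moment_jac A) = c *\<^sub>R (\<Sum>t\<in>I. transpose (?J t))"
    unfolding moment_jac_def
    by (simp only: linear_scale linear_sum bounded_linear_transpose[THEN bounded_linear.linear])
  have L: "transpose L = L" "L ** info = mat 1"
    using inv transpose_info by (auto simp: L_def transpose_matrix_inv matrix_mul_inv_left)
  have G: "G ** moment_jac A = mat 1" using inv by (simp add: G_def matrix_mul_inv_left)
  have Gt: "transpose (moment_jac A) ** transpose G = mat 1"
    by (metis G matrix_transpose_mul transpose_mat)
  have "c *\<^sub>R (\<Sum>t\<in>I. \<integral>\<omega>. excess_var A t \<omega> \<partial>M)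
      = c *\<^sub>R (\<Sum>t\<in>I. G ** ?V t ** transpose G - G ** ?J t ** transpose L
         - (L ** transpose (?J t) ** transpose G - L ** ?E t ** transpose L))"
    using has_bochner_integral_excess_var[OF A, THEN has_bochner_integral_integral_eq]
    by (simp add: G_def L_def)
  also have "\<dots> = G ** moment_var A ** transpose G - G ** moment_jac A ** transpose L
      - (L ** transpose (moment_jac A) ** transpose G - L ** info ** transpose L)"
    unfolding tr unfolding moment_var_def moment_jac_def info_def matrix_sandwich_average
    by (simp add: sum_subtractf scaleR_diff_right)
  also have "\<dots> = G ** moment_var A ** transpose G - L"
    by (simp add: G L(1) L(2) matrix_mul_assoc[symmetric] Gt)
  finally show ?thesis by (simp add: sandwich_def G_def L_def)
qed

lemma pos_semidef_excess_var:
  assumes "admissible A" "t \<in> I"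
  shows "pos_semidef (\<integral>\<omega>. excess_var A t \<omega> \<partial>M)"
proof (rule pos_semidef_integral)
  show "integrable M (excess_var A t)"
    using has_bochner_integral_excess_var[OF assms] by (auto simp: integrable.simps)
  show "AE \<omega> in M. pos_semidef (excess_var A t \<omega>)"
    using S[OF assms(2)] AE_excess_var[OF assms(2), of A]
    by eventually_elim (simp add: pos_semidef_congruence)
qed

lemma variance_bound:
  assumes A: "admissible A" and inv: "invertible (moment_jac A)" "invertible info"
  shows "sandwich (moment_jac A) (moment_var A) \<succeq>\<^sub>L matrix_inv info"
  unfolding loewner_ge_def sandwich_minus_eq[OF assms]
  using c A by (intro pos_semidef_scaleR pos_semidef_sum pos_semidef_excess_var) auto

text \<open>A vanishing excess reads \<open>\<Delta>\<^sup>-\<^sup>1 A\<^sub>t = \<Lambda>\<^sup>-\<^sup>1 D\<^sub>t\<^sup>T S\<^sub>t\<^sup>-\<^sup>1\<close>; multiplying by \<open>\<Delta>\<close> exhibits \<open>A\<^sub>t\<close> as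
  efficient with the factor \<open>\<Delta> \<Lambda>\<^sup>-\<^sup>1\<close> in the role of \<open>C\<close>.\<close>

lemma efficient_if_bound_attained:
  assumes A: "admissible A" and inv: "invertible (moment_jac A)" "invertible info"
    and eq: "sandwich (moment_jac A) (moment_var A) = matrix_inv info" and t: "t \<in> I"
  shows "AE \<omega> in M. A t \<omega> =
    (moment_jac A ** matrix_inv info) ** transpose (D t \<omega>) ** matrix_inv (S t \<omega>)"
proof -
  let ?Q = "\<lambda>t. \<integral>\<omega>. excess_var A t \<omega> \<partial>M"
  have "(\<Sum>t\<in>I. ?Q t) = 0"
    using sandwich_minus_eq[OF A inv] c eq by simp
  then have Q: "?Q t = 0"
    using pos_semidef_sum_eq_0[OF finite_I, of ?Q] pos_semidef_excess_var[OF A] t by blast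
  have "AE \<omega> in M. excess A t \<omega> = 0"
    using has_bochner_integral_excess_var[OF A t] AE_excess_var[OF t, of A] S[OF t] Q
    by (intro AE_zero_if_integral_congruence_zero[where P = "excess_var A t" and S = "S t"])
      (auto simp: integrable.simps)
  then show ?thesis
  proof eventually_elim
    case (elim \<omega>)
    then have "matrix_inv (moment_jac A) ** A t \<omega>
        = matrix_inv info ** transpose (D t \<omega>) ** matrix_inv (S t \<omega>)"
      by (simp add: excess_def)
    then have "moment_jac A ** (matrix_inv (moment_jac A) ** A t \<omega>)
        = moment_jac A ** (matrix_inv info ** transpose (D t \<omega>) ** matrix_inv (S t \<omega>))"
      by simp
    then show ?case
      by (simp add: matrix_mul_assoc matrix_mul_inv_right inv)
  qed
qed

text \<open>For the efficient instruments the moment variance and the moment Jacobian both reduce to the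
  information \<open>\<Lambda>\<close>, up to the factor \<open>C\<close>, which the sandwich removes.\<close>

lemma sandwich_efficient:
  assumes eff: "\<And>t. t \<in> I \<Longrightarrow> AE \<omega> in M. A t \<omega> = C ** transpose (D t \<omega>) ** matrix_inv (S t \<omega>)"
    and A: "admissible A" and inv: "invertible C" "invertible info"
  shows "sandwich (moment_jac A) (moment_var A) = matrix_inv info"
proof -
  let ?E = "\<lambda>t \<omega>. transpose (D t \<omega>) ** matrix_inv (S t \<omega>) ** D t \<omega>"
  have avg: "c *\<^sub>R (\<Sum>t\<in>I. C ** (\<integral>\<omega>. ?E t \<omega> \<partial>M) ** H) = C ** info ** H" for H :: "real ^ 'q ^ 'q"
    by (simp add: info_def matrix_sandwich_average)
  have lin: "(\<integral>\<omega>. C ** ?E t \<omega> ** H \<partial>M) = C ** (\<integral>\<omega>. ?E t \<omega> \<partial>M) ** H"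
    "integrable M (\<lambda>\<omega>. C ** ?E t \<omega> ** H)" if "t \<in> I" for t and H :: "real ^ 'q ^ 'q"
    using that integral_bounded_linear[OF bounded_linear_matrix_sandwich info_integrable]
      integrable_bounded_linear[OF bounded_linear_matrix_sandwich info_integrable] by blast+
  have J: "(\<integral>\<omega>. A t \<omega> ** D t \<omega> \<partial>M) = C ** (\<integral>\<omega>. ?E t \<omega> \<partial>M) ** mat 1" if t: "t \<in> I" for t
    unfolding lin(1)[OF t, symmetric]
    using A t lin(2)[OF t, of "mat 1"] eff[OF t]
    by (intro integral_cong_AE borel_measurable_integrable)
      (auto simp: admissible_def matrix_mul_assoc)
  have V: "(\<integral>\<omega>. A t \<omega> ** S t \<omega> ** transpose (A t \<omega>) \<partial>M) = C ** (\<integral>\<omega>. ?E t \<omega> \<partial>M) ** transpose C"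
    if t: "t \<in> I" for t
    unfolding lin(1)[OF t, symmetric]
  proof (intro integral_cong_AE borel_measurable_integrable lin(2)[OF t])
    show "integrable M (\<lambda>\<omega>. A t \<omega> ** S t \<omega> ** transpose (A t \<omega>))"
      using A t by (simp add: admissible_def)
    show "AE \<omega> in M. A t \<omega> ** S t \<omega> ** transpose (A t \<omega>) = C ** ?E t \<omega> ** transpose C"
      using eff[OF t] S[OF t]
    proof eventually_elim
      case (elim \<omega>)
      have "transpose (A t \<omega>) = matrix_inv (S t \<omega>) ** D t \<omega> ** transpose C"
        using elim by (simp add: matrix_transpose_mul transpose_matrix_inv pos_semidef_def
            matrix_mul_assoc)
      moreover have "A t \<omega> ** S t \<omega> = C ** transpose (D t \<omega>)"
        using elim by (metis matrix_mul_assoc matrix_mul_inv_left matrix_mul_rid)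
      ultimately show ?case by (simp add: matrix_mul_assoc)
    qed
  qed
  have moment_jac: "moment_jac A = C ** info"
    using avg[of "mat 1"] by (simp add: moment_jac_def J)
  have moment_var: "moment_var A = C ** info ** transpose C"
    using avg by (simp add: moment_var_def V)
  define G where "G = matrix_inv (C ** info)"
  have G: "G ** (C ** info) = mat 1"
    unfolding G_def using inv by (intro matrix_mul_inv_left invertible_mult)
  have "transpose (C ** info) ** transpose G = mat 1"
    by (metis G matrix_transpose_mul transpose_mat)
  then have "info ** (transpose C ** transpose G) = mat 1"
    by (simp add: matrix_transpose_mul transpose_info matrix_mul_assoc)
  then have "transpose C ** transpose G = matrix_inv info"
    by (metis inv(2) matrix_mul_assoc matrix_mul_inv_left matrix_mul_lid matrix_mul_rid)
  moreover have "sandwich (moment_jac A) (moment_var A) = (G ** (C ** info)) ** (transpose C ** transpose G)"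
    by (simp add: sandwich_def moment_jac moment_var G_def matrix_mul_assoc)
  ultimately show ?thesis by (simp add: G)
qed

end

section \<open>The efficiency theorem\<close>

theorem theorem4p1:
  fixes M :: "'w measure"
    and Y :: "nat \<Rightarrow> 'w \<Rightarrow> real"
    and X :: "nat \<Rightarrow> 'w \<Rightarrow> real ^ 'p"
    and FZ :: "(nat \<Rightarrow> (real \<times> (real ^ 'p)) measure) set"
    and \<kappa> :: "(real \<times> (real ^ 'p)) measure \<Rightarrow> real ^ 'p \<Rightarrow> real measure"
    and F :: "nat \<Rightarrow> real ^ 'p \<Rightarrow> real measure"
    and \<Gamma> :: "real measure \<Rightarrow> real ^ 'k"
    and \<Xi> :: "(real ^ 'k) set"
    and \<Theta> :: "(real ^ 'q) set"
    and m :: "real ^ 'p \<Rightarrow> real ^ 'q \<Rightarrow> real ^ 'k"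
    and \<phi> :: "real \<Rightarrow> real ^ 'k \<Rightarrow> real ^ 'k"
    and \<theta>0 :: "real ^ 'q"
    and S :: "nat \<Rightarrow> real ^ 'p \<Rightarrow> real ^ 'q \<Rightarrow> real ^ 'k ^ 'k"
    and D :: "nat \<Rightarrow> real ^ 'p \<Rightarrow> real ^ 'q \<Rightarrow> real ^ 'q ^ 'k"
    and C :: "real ^ 'q ^ 'q"
    and Astar :: "nat \<Rightarrow> real ^ 'p \<Rightarrow> real ^ 'q \<Rightarrow> real ^ 'k ^ 'q"
    and \<theta>hat :: "nat \<Rightarrow> 'w \<Rightarrow> real ^ 'q"
    and \<Lambda> :: "nat \<Rightarrow> real ^ 'q ^ 'q"
    and \<Sigma> \<Delta> :: "(nat \<Rightarrow> real ^ 'p \<Rightarrow> real ^ 'q \<Rightarrow> real ^ 'k ^ 'q) \<Rightarrow> nat \<Rightarrow> real ^ 'q ^ 'q"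
  assumes prob: "prob_space M"
    and rv_Y: "\<forall>t\<ge>1. Y t \<in> borel_measurable M"
    and rv_X: "\<forall>t\<ge>1. X t \<in> borel_measurable M"
    and FZ: "distribution_class FZ \<kappa>"
    and Z_in_FZ: "joint_law M Y X \<in> FZ"
    and F_def: "F = (\<lambda>t. \<kappa> (joint_law M Y X t))"
    and \<Gamma>: "measurable_functional (induced_class FZ \<kappa>) \<Xi> \<Gamma>"
    and \<Theta>: "interior \<Theta> \<noteq> {}"
    and m: "parametric_model \<Theta> \<Xi> m"
    and A1: "correctly_specified FZ \<kappa> \<Gamma> \<Theta> m"
    and \<theta>0_def: "\<theta>0 = true_param \<kappa> \<Gamma> \<Theta> m (joint_law M Y X)"
    and \<phi>: "strict_id_fun (induced_class FZ \<kappa>) \<Xi> \<Gamma> \<phi>"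
    and S_def: "S = S_mat \<phi> m F"
    and D_def: "D = D_mat \<phi> m F"
    and S_exists: "\<forall>t\<ge>1. AE \<omega> in M.
          integrable (F t (X t \<omega>)) (\<lambda>y. outer (\<phi> y (m (X t \<omega>) \<theta>0)) (\<phi> y (m (X t \<omega>) \<theta>0)))"
    and D_exists: "\<forall>t\<ge>1. AE \<omega> in M.
          (\<lambda>\<theta>. \<integral>y. \<phi> y (m (X t \<omega>) \<theta>) \<partial>(F t (X t \<omega>))) differentiable (at \<theta>0)"
    and S_inv: "\<forall>t\<ge>1. AE \<omega> in M. invertible (S t (X t \<omega>) \<theta>0)"
    and \<Sigma>_def: "\<Sigma> = Sigma_mat M X S \<theta>0"
    and \<Delta>_def: "\<Delta> = Delta_mat M X D \<theta>0"
    and \<Lambda>_def: "\<Lambda> = Lambda_mat M X S D \<theta>0"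
    and \<Lambda>_exists: "\<forall>t\<ge>1. integrable M
          (\<lambda>\<omega>. transpose (D t (X t \<omega>) \<theta>0) ** matrix_inv (S t (X t \<omega>) \<theta>0) ** D t (X t \<omega>) \<theta>0)"
    and \<Lambda>_inv: "\<forall>\<^sub>F T in sequentially. invertible (\<Lambda> T)"
    and C: "invertible C"
    and Astar: "instrument_matrices M X \<Theta> S D \<theta>0 Astar"
    and Astar_eff: "\<forall>t\<ge>1. AE \<omega> in M.
          Astar t (X t \<omega>) \<theta>0 = efficient_instrument S D C t (X t \<omega>) \<theta>0"
    and Astar_id: "strict_uncond_id_funs FZ \<Theta> (true_param \<kappa> \<Gamma> \<Theta> m) (moment_fun \<phi> m Astar)"
    and A2: "uncorrelated_seq M (\<lambda>t \<omega>. moment_fun \<phi> m Astar t (Y t \<omega>) (X t \<omega>) \<theta>0)"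
    and \<theta>hat: "is_Z_estimator M Y X \<Theta> (moment_fun \<phi> m Astar) \<theta>hat"
    and normal: "asymptotically_normal M (\<Delta> Astar) (\<Sigma> Astar) \<theta>hat \<theta>0"
  shows
    "(\<forall>V. is_asymptotic_covariance (\<Delta> Astar) (\<Sigma> Astar) V
          \<longleftrightarrow> (\<lambda>T. matrix_inv (\<Lambda> T)) \<longlonglongrightarrow> V) \<and>
     (\<forall>A. instrument_matrices M X \<Theta> S D \<theta>0 A \<longrightarrow>
        (\<forall>T\<ge>1. invertible (\<Delta> A T) \<and> invertible (\<Lambda> T) \<longrightarrow>
           sandwich (\<Delta> A T) (\<Sigma> A T) \<succeq>\<^sub>L matrix_inv (\<Lambda> T))) \<and>
     (\<forall>A. instrument_matrices M X \<Theta> S D \<theta>0 A \<longrightarrow>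
        (\<forall>T\<ge>1. invertible (\<Delta> A T) \<and> invertible (\<Lambda> T) \<and>
           (\<exists>t\<in>{1..T}. \<forall>C'. invertible C' \<longrightarrow>
              \<not> (AE \<omega> in M. A t (X t \<omega>) \<theta>0 = efficient_instrument S D C' t (X t \<omega>) \<theta>0)) \<longrightarrow>
           sandwich (\<Delta> A T) (\<Sigma> A T) \<succeq>\<^sub>L matrix_inv (\<Lambda> T) \<and>
           sandwich (\<Delta> A T) (\<Sigma> A T) \<noteq> matrix_inv (\<Lambda> T)))"
proof -
  have S_pd: "AE \<omega> in M. pos_semidef (S t (X t \<omega>) \<theta>0) \<and> invertible (S t (X t \<omega>) \<theta>0)" if "t \<ge> 1" for t
    using S_exists[rule_format, OF that] S_inv[rule_format, OF that]
    by eventually_elim (simp add: S_def pos_semidef_S_mat)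
  have moments: "gmm_moments M (\<lambda>t \<omega>. S t (X t \<omega>) \<theta>0) (\<lambda>t \<omega>. D t (X t \<omega>) \<theta>0) {1..T} (1 / real T)"
    if "T \<ge> 1" for T
    using that S_pd \<Lambda>_exists by unfold_locales auto
  have adm: "gmm_moments.admissible M (\<lambda>t \<omega>. S t (X t \<omega>) \<theta>0) (\<lambda>t \<omega>. D t (X t \<omega>) \<theta>0) {1..T}
      (\<lambda>t \<omega>. A t (X t \<omega>) \<theta>0)"
    if "T \<ge> 1" "instrument_matrices M X \<Theta> S D \<theta>0 A" for A T
    using that(2) unfolding gmm_moments.admissible_def[OF moments[OF that(1)]] instrument_matrices_def
    by auto
  have info: "gmm_moments.info M (\<lambda>t \<omega>. S t (X t \<omega>) \<theta>0) (\<lambda>t \<omega>. D t (X t \<omega>) \<theta>0) {1..T} (1 / real T) = \<Lambda> T"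
    and moment_var: "gmm_moments.moment_var M (\<lambda>t \<omega>. S t (X t \<omega>) \<theta>0) {1..T} (1 / real T) (\<lambda>t \<omega>. A t (X t \<omega>) \<theta>0) = \<Sigma> A T"
    and moment_jac: "gmm_moments.moment_jac M (\<lambda>t \<omega>. D t (X t \<omega>) \<theta>0) {1..T} (1 / real T) (\<lambda>t \<omega>. A t (X t \<omega>) \<theta>0) = \<Delta> A T"
    if "T \<ge> 1" for T A
    unfolding gmm_moments.info_def[OF moments[OF that]] gmm_moments.moment_var_def[OF moments[OF that]]
      gmm_moments.moment_jac_def[OF moments[OF that]] \<Lambda>_def \<Sigma>_def \<Delta>_def
      Lambda_mat_def Sigma_mat_def Delta_mat_def by (rule refl)+
  note to_moments = info moment_var moment_jac

  have bound: "sandwich (\<Delta> A T) (\<Sigma> A T) \<succeq>\<^sub>L matrix_inv (\<Lambda> T)"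
    if "instrument_matrices M X \<Theta> S D \<theta>0 A" "T \<ge> 1" "invertible (\<Delta> A T)" "invertible (\<Lambda> T)" for A T
    using gmm_moments.variance_bound[OF moments adm, of T A] that by (simp only: to_moments)

  have eq_efficient: "AE \<omega> in M. A t (X t \<omega>) \<theta>0
      = efficient_instrument S D (\<Delta> A T ** matrix_inv (\<Lambda> T)) t (X t \<omega>) \<theta>0"
    if "instrument_matrices M X \<Theta> S D \<theta>0 A" "T \<ge> 1" "invertible (\<Delta> A T)" "invertible (\<Lambda> T)"
      "sandwich (\<Delta> A T) (\<Sigma> A T) = matrix_inv (\<Lambda> T)" "t \<in> {1..T}" for A T t
    using gmm_moments.efficient_if_bound_attained[OF moments adm, of T A t] that
    by (simp only: to_moments efficient_instrument_def)

  have attained: "sandwich (\<Delta> Astar T) (\<Sigma> Astar T) = matrix_inv (\<Lambda> T)"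
    if T: "T \<ge> 1" and inv: "invertible (\<Lambda> T)" for T
  proof -
    have "AE \<omega> in M. Astar t (X t \<omega>) \<theta>0
        = C ** transpose (D t (X t \<omega>) \<theta>0) ** matrix_inv (S t (X t \<omega>) \<theta>0)" if "t \<in> {1..T}" for t
      using Astar_eff that by (simp add: efficient_instrument_def)
    from gmm_moments.sandwich_efficient[OF moments[OF T] this adm[OF T Astar] C] inv
    show ?thesis by (simp only: to_moments[OF T])
  qed
  have "\<forall>\<^sub>F T in sequentially. sandwich (\<Delta> Astar T) (\<Sigma> Astar T) = matrix_inv (\<Lambda> T)"
    using \<Lambda>_inv eventually_ge_at_top[of 1] by eventually_elim (rule attained)
  then have i: "is_asymptotic_covariance (\<Delta> Astar) (\<Sigma> Astar) V
      \<longleftrightarrow> (\<lambda>T. matrix_inv (\<Lambda> T)) \<longlonglongrightarrow> V" for V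
    unfolding is_asymptotic_covariance_def by (rule tendsto_cong)

  have iii: "sandwich (\<Delta> A T) (\<Sigma> A T) \<noteq> matrix_inv (\<Lambda> T)"
    if A: "instrument_matrices M X \<Theta> S D \<theta>0 A" and T: "T \<ge> 1"
      and inv: "invertible (\<Delta> A T)" "invertible (\<Lambda> T)"
      and t: "t \<in> {1..T}" and ne: "\<forall>C'. invertible C' \<longrightarrow>
        \<not> (AE \<omega> in M. A t (X t \<omega>) \<theta>0 = efficient_instrument S D C' t (X t \<omega>) \<theta>0)" for A T t
    using ne eq_efficient[OF A T inv _ t] invertible_mult[OF inv(1) invertible_matrix_inv[OF inv(2)]]
    by blast
  show ?thesis using i bound iii by blast
qed

end
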